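(* Let $q_{\mathrm s}=q(t_{\mathrm s})$ be a configuration with $\Phi(q_{\mathrm s})=0$, and let $\nu^-=\nu(t_{\mathrm s}^-)\in\mathbb{R}^6$ be a pre-impact velocity for which there is a solution $(z,\mu)$ of the distance problem at $q_{\mathrm s}$ with $n(z,\mu,q_{\mathrm s})^\top\nu^-<0$. Let $w_1,\dots,w_{n_{\mathrm v}}$ be the vertices of the polytopic contact patch $\{p:\ (z,\mu)\text{ solves the distance problem at }q_{\mathrm s},\ z=(p,\alpha,y_1,y_2)\}$, and let $\tilde n_i=n(\tilde z_i,\mu,q_{\mathrm s})$, where $\tilde z_i$ is an optimal primal solution at $q_{\mathrm s}$ with $p$-component $w_i$. Then for $\nu^+\in\mathbb{R}^6$ the following two impact laws are equivalent, i.e. $\nu^+$ satisfies (A) if and only if it satisfies (B): (A) (Moreau's impact law for the vertices) There exist $\tilde\Lambda_{\mathrm n,i}\ge0$, $i=1,\dots,n_{\mathrm v}$, such that $$\nu^+=\nu^-+M^{-1}\sum_{i=1}^{n_{\mathrm v}}\tilde n_i\tilde\Lambda_{\mathrm n,i},\qquad 0\le\tilde n_i^\top\nu^+\ (i=1,\dots,n_{\mathrm v}),\qquad 0=\Big(\sum_{i=1}^{n_{\mathrm v}}\tilde\Lambda_{\mathrm n,i}\tilde n_i\Big)^\top\nu^+.$$ (B) There exist $\Lambda_{\mathrm n}\ge0$ and $(z_{\mathrm I},\mu_{\mathrm I})$ solving the distance problem at $q_{\mathrm s}$ such that $$\nu^+=\nu^-+M^{-1}n(z_{\mathrm I},\mu_{\mathrm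 I},q_{\mathrm s})\Lambda_{\mathrm n},\qquad 0=n(z_{\mathrm I},\mu_{\mathrm I},q_{\mathrm s})^\top\nu^+,$$ $$0\le n(\hat z_{\mathrm I},\hat\mu_{\mathrm I},q_{\mathrm s})^\top\nu^+\quad\text{for all }(\hat z_{\mathrm I},\hat\mu_{\mathrm I})\text{ solving the distance problem at }q_{\mathrm s}.$$
   Context: Setting. For $i=1,2$, $\mathcal{P}_i=\{x\in\mathbb{R}^2: A_ix\le b_i\}$ is a (bounded) planar polytope, with $A_i\in\mathbb{R}^{n_{i,\mathrm h}\times 2}$ and $b_i\in\mathbb{R}^{n_{i,\mathrm h}}$. The rows of $A_i$ have Euclidean norm one. The scalar $r>0$ satisfies $b_i-\mathbf{1}r>0$ componentwise ($\mathbf 1$ is the all-ones vector). The polytopes are assumed non-degenerate: two distinct halfspace constraints of the same body that are active at an optimal point of the distance problem below with positive multipliers have linearly independent normals. $R(\theta)=\begin{pmatrix}\cos\theta&-\sin\theta\\ \sin\theta&\cos\theta\end{pmatrix}$, and $a\times b=a_1b_2-a_2b_1$ for $a,b\in\mathbb{R}^2$. Configuration $q=(c_1,\xi_1,c_2,\xi_2)\in\mathbb{R}^6$ ($c_i\in\mathbb{R}^2$, $\xi_i\in\mathbb{R}$); velocity $\nu\in\mathbb{R}^6$. The inertia matrix $M\in\mathbb{R}^{6\times6}$ is diagonal and positive definite. Distance problem at $q$: $\Phi(q)=\min_{z}\ \alpha-1$ over $z=(p,\alpha,y_1,y_2)\in\mathbb{R}^2\times\mathbb{R}\times\mathbb{R}^2\times\mathbb{R}^2$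 subject to $A_1R(\xi_1)^\top(y_1-c_1)\le\alpha b_1-\mathbf1r$, $A_2R(\xi_2)^\top(y_2-c_2)\le\alpha b_2-\mathbf1r$, $(p-y_1)^\top(p-y_1)\le r^2$, $(p-y_2)^\top(p-y_2)\le r^2$, with nonnegative Lagrange multipliers $\mu=(\mu_{1,\mathrm p},\mu_{2,\mathrm p},\mu_{1,\mathrm c},\mu_{2,\mathrm c})$ in the order of the constraints. "$(z,\mu)$ solves the distance problem at $q$" means that $z$ is primal optimal and $\mu$ dual optimal (the Karush-Kuhn-Tucker conditions hold). The optimal $\mu$ is unique whenever $c_1\ne c_2$. Contact normal: $$n(z,\mu,q)=\begin{pmatrix}n_{\mathrm{tr}}\\(p-c_1)\times n_{\mathrm{tr}}\\-n_{\mathrm{tr}}\\-(p-c_2)\times n_{\mathrm{tr}}\end{pmatrix}\in\mathbb{R}^6,\qquad n_{\mathrm{tr}}=-R(\xi_1)A_1^\top\mu_{1,\mathrm p}.$$ Interpretation of the vertex normals: $\tilde n_i=\nabla_q\tilde\Phi_i(q_{\mathrm s})$, where $\tilde\Phi_i$ is a continuously differentiable signed distance function encoding the distance between the point $w_i$, virtually fixed to one body, and the other body, with $\tilde\Phi_i(q_{\mathrm s})=0$. By definition these satisfy $\tilde n_i=n(\tilde z_i,\mu,q_{\mathrm s})$ as in the claim. The contact patch is the convex hull of $w_1,\dots,w_{n_{\mathrm v}}$. *)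

theory Defs
  imports "HOL-Analysis.Analysis"
begin

text \<open>A configuration is \<open>q = (c1, \<xi>1, c2, \<xi>2)\<close>, a primal point is \<open>z = (p, \<alpha>, y1, y2)\<close>, and a
  multiplier is \<open>\<mu> = (\<mu>1p, \<mu>2p, \<mu>1c, \<mu>2c)\<close>.  Body \<open>i\<close> is given by the data \<open>A\<close>, \<open>b\<close> of
  \<open>{x. A *v x \<le> b}\<close>, where \<open>\<le>\<close> on vectors is the componentwise order.\<close>

type_synonym config = "(real ^ 2) \<times> real \<times> (real ^ 2) \<times> real"
type_synonym primal = "(real ^ 2) \<times> real \<times> (real ^ 2) \<times> (real ^ 2)"
type_synonym ('m, 'n) multiplier = "(real ^ 'm) \<times> (real ^ 'n) \<times> real \<times> real"

definition rot :: "real \<Rightarrow> real ^ 2 ^ 2" where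
  "rot \<theta> = vector [vector [cos \<theta>, - sin \<theta>], vector [sin \<theta>, cos \<theta>]]"

definition cross2 :: "real ^ 2 \<Rightarrow> real ^ 2 \<Rightarrow> real" where
  "cross2 a b = a $ 1 * b $ 2 - a $ 2 * b $ 1"

text \<open>The constraints of the distance problem are \<open>\<dots> \<le> 0\<close> for the following two functions; \<open>vec r\<close> is the
  vector with all entries \<open>r\<close>.\<close>

definition halfspace_con ::
  "real ^ 2 ^ 'm \<Rightarrow> real ^ 'm \<Rightarrow> real \<Rightarrow> real ^ 2 \<Rightarrow> real \<Rightarrow> real \<Rightarrow> real ^ 2 \<Rightarrow> real ^ 'm" where
  "halfspace_con A b r c \<xi> \<alpha> y =
     A *v (transpose (rot \<xi>) *v (y - c)) - (\<alpha> *\<^sub>R b - vec r)"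

definition disc_con :: "real \<Rightarrow> real ^ 2 \<Rightarrow> real ^ 2 \<Rightarrow> real" where
  "disc_con r p y = (p - y) \<bullet> (p - y) - r\<^sup>2"

fun feasible ::
  "real ^ 2 ^ 'm \<Rightarrow> real ^ 'm \<Rightarrow> real ^ 2 ^ 'n \<Rightarrow> real ^ 'n \<Rightarrow> real \<Rightarrow> config \<Rightarrow> primal \<Rightarrow> bool" where
  "feasible A1 b1 A2 b2 r (c1, \<xi>1, c2, \<xi>2) (p, \<alpha>, y1, y2) \<longleftrightarrow>
     halfspace_con A1 b1 r c1 \<xi>1 \<alpha> y1 \<le> 0 \<and> halfspace_con A2 b2 r c2 \<xi>2 \<alpha> y2 \<le> 0 \<and>
     disc_con r p y1 \<le> 0 \<and> disc_con r p y2 \<le> 0"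

fun objective :: "primal \<Rightarrow> real" where
  "objective (p, \<alpha>, y1, y2) = \<alpha> - 1"

definition Phi ::
  "real ^ 2 ^ 'm \<Rightarrow> real ^ 'm \<Rightarrow> real ^ 2 ^ 'n \<Rightarrow> real ^ 'n \<Rightarrow> real \<Rightarrow> config \<Rightarrow> real" where
  "Phi A1 b1 A2 b2 r q = (INF z \<in> {z. feasible A1 b1 A2 b2 r q z}. objective z)"

definition primal_optimal ::
  "real ^ 2 ^ 'm \<Rightarrow> real ^ 'm \<Rightarrow> real ^ 2 ^ 'n \<Rightarrow> real ^ 'n \<Rightarrow> real \<Rightarrow> config \<Rightarrow> primal \<Rightarrow> bool" where
  "primal_optimal A1 b1 A2 b2 r q z \<longleftrightarrow>
     feasible A1 b1 A2 b2 r q z \<and>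
     (\<forall>z'. feasible A1 b1 A2 b2 r q z' \<longrightarrow> objective z \<le> objective z')"

fun lagrangian ::
  "real ^ 2 ^ 'm \<Rightarrow> real ^ 'm \<Rightarrow> real ^ 2 ^ 'n \<Rightarrow> real ^ 'n \<Rightarrow> real \<Rightarrow> config \<Rightarrow>
   ('m, 'n) multiplier \<Rightarrow> primal \<Rightarrow> real" where
  "lagrangian A1 b1 A2 b2 r (c1, \<xi>1, c2, \<xi>2) (\<mu>1p, \<mu>2p, \<mu>1c, \<mu>2c) (p, \<alpha>, y1, y2) =
     (\<alpha> - 1)
     + \<mu>1p \<bullet> halfspace_con A1 b1 r c1 \<xi>1 \<alpha> y1 + \<mu>2p \<bullet> halfspace_con A2 b2 r c2 \<xi>2 \<alpha> y2
     + \<mu>1c * disc_con r p y1 + \<mu>2c * disc_con r p y2"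

fun nonneg_multiplier :: "('m::finite, 'n::finite) multiplier \<Rightarrow> bool" where
  "nonneg_multiplier (\<mu>1p, \<mu>2p, \<mu>1c, \<mu>2c) \<longleftrightarrow> 0 \<le> \<mu>1p \<and> 0 \<le> \<mu>2p \<and> 0 \<le> \<mu>1c \<and> 0 \<le> \<mu>2c"

definition dual_function ::
  "real ^ 2 ^ 'm \<Rightarrow> real ^ 'm \<Rightarrow> real ^ 2 ^ 'n \<Rightarrow> real ^ 'n \<Rightarrow> real \<Rightarrow> config \<Rightarrow>
   ('m, 'n) multiplier \<Rightarrow> ereal" where
  "dual_function A1 b1 A2 b2 r q \<mu> = (INF z. ereal (lagrangian A1 b1 A2 b2 r q \<mu> z))"

definition dual_optimal ::
  "real ^ 2 ^ 'm \<Rightarrow> real ^ 'm \<Rightarrow> real ^ 2 ^ 'n \<Rightarrow> real ^ 'n \<Rightarrow> real \<Rightarrow> config \<Rightarrow>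
   ('m, 'n) multiplier \<Rightarrow> bool" where
  "dual_optimal A1 b1 A2 b2 r q \<mu> \<longleftrightarrow>
     nonneg_multiplier \<mu> \<and>
     (\<forall>\<mu>'. nonneg_multiplier \<mu>' \<longrightarrow>
        dual_function A1 b1 A2 b2 r q \<mu>' \<le> dual_function A1 b1 A2 b2 r q \<mu>)"

fun complementary ::
  "real ^ 2 ^ 'm \<Rightarrow> real ^ 'm \<Rightarrow> real ^ 2 ^ 'n \<Rightarrow> real ^ 'n \<Rightarrow> real \<Rightarrow> config \<Rightarrow>
   primal \<Rightarrow> ('m, 'n) multiplier \<Rightarrow> bool" where
  "complementary A1 b1 A2 b2 r (c1, \<xi>1, c2, \<xi>2) (p, \<alpha>, y1, y2) (\<mu>1p, \<mu>2p, \<mu>1c, \<mu>2c) \<longleftrightarrow>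
     (\<forall>i. \<mu>1p $ i * halfspace_con A1 b1 r c1 \<xi>1 \<alpha> y1 $ i = 0) \<and>
     (\<forall>i. \<mu>2p $ i * halfspace_con A2 b2 r c2 \<xi>2 \<alpha> y2 $ i = 0) \<and>
     \<mu>1c * disc_con r p y1 = 0 \<and> \<mu>2c * disc_con r p y2 = 0"

definition kkt ::
  "real ^ 2 ^ 'm \<Rightarrow> real ^ 'm \<Rightarrow> real ^ 2 ^ 'n \<Rightarrow> real ^ 'n \<Rightarrow> real \<Rightarrow> config \<Rightarrow>
   primal \<Rightarrow> ('m, 'n) multiplier \<Rightarrow> bool" where
  "kkt A1 b1 A2 b2 r q z \<mu> \<longleftrightarrow>
     feasible A1 b1 A2 b2 r q z \<and> nonneg_multiplier \<mu> \<and>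
     (lagrangian A1 b1 A2 b2 r q \<mu> has_derivative (\<lambda>_. 0)) (at z) \<and>
     complementary A1 b1 A2 b2 r q z \<mu>"

text \<open>The problem is convex and satisfies Slater's condition whenever \<open>0 < r\<close>, \<open>0 < b1\<close> and \<open>0 < b2\<close> componentwise,
  so the last conjunct below is equivalent to the first two.\<close>

definition solves ::
  "real ^ 2 ^ 'm \<Rightarrow> real ^ 'm \<Rightarrow> real ^ 2 ^ 'n \<Rightarrow> real ^ 'n \<Rightarrow> real \<Rightarrow> config \<Rightarrow>
   primal \<Rightarrow> ('m, 'n) multiplier \<Rightarrow> bool" where
  "solves A1 b1 A2 b2 r q z \<mu> \<longleftrightarrow>
     primal_optimal A1 b1 A2 b2 r q z \<and> dual_optimal A1 b1 A2 b2 r q \<mu> \<and> kkt A1 b1 A2 b2 r q z \<mu>"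

text \<open>Linear independence is that of the indexed family: two different constraints with the same normal
  are dependent, hence the separate inequality of the rows.\<close>

definition nondegenerate ::
  "real ^ 2 ^ 'm \<Rightarrow> real ^ 'm \<Rightarrow> real ^ 2 ^ 'n \<Rightarrow> real ^ 'n \<Rightarrow> real \<Rightarrow> config \<Rightarrow> bool" where
  "nondegenerate A1 b1 A2 b2 r q \<longleftrightarrow>
     (case q of (c1, \<xi>1, c2, \<xi>2) \<Rightarrow>
       \<forall>p \<alpha> y1 y2 \<mu>1p \<mu>2p \<mu>1c \<mu>2c.
         solves A1 b1 A2 b2 r q (p, \<alpha>, y1, y2) (\<mu>1p, \<mu>2p, \<mu>1c, \<mu>2c) \<longrightarrow>
           (\<forall>i j. i \<noteq> j \<and>
              halfspace_con A1 b1 r c1 \<xi>1 \<alpha> y1 $ i = 0 \<and> halfspace_con A1 b1 r c1 \<xi>1 \<alpha> y1 $ j = 0 \<and>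
              0 < \<mu>1p $ i \<and> 0 < \<mu>1p $ j \<longrightarrow>
              row i A1 \<noteq> row j A1 \<and> independent {row i A1, row j A1}) \<and>
           (\<forall>i j. i \<noteq> j \<and>
              halfspace_con A2 b2 r c2 \<xi>2 \<alpha> y2 $ i = 0 \<and> halfspace_con A2 b2 r c2 \<xi>2 \<alpha> y2 $ j = 0 \<and>
              0 < \<mu>2p $ i \<and> 0 < \<mu>2p $ j \<longrightarrow>
              row i A2 \<noteq> row j A2 \<and> independent {row i A2, row j A2}))"

fun contact_normal ::
  "real ^ 2 ^ 'm \<Rightarrow> primal \<Rightarrow> ('m, 'n) multiplier \<Rightarrow> config \<Rightarrow> real ^ 6" where
  "contact_normal A1 (p, \<alpha>, y1, y2) (\<mu>1p, \<mu>2p, \<mu>1c, \<mu>2c) (c1, \<xi>1, c2, \<xi>2) =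
     (let ntr = - (rot \<xi>1 *v (transpose A1 *v \<mu>1p)) in
      vector [ntr $ 1, ntr $ 2, cross2 (p - c1) ntr,
              - (ntr $ 1), - (ntr $ 2), - cross2 (p - c2) ntr])"

definition contact_patch ::
  "real ^ 2 ^ 'm \<Rightarrow> real ^ 'm \<Rightarrow> real ^ 2 ^ 'n \<Rightarrow> real ^ 'n \<Rightarrow> real \<Rightarrow> config \<Rightarrow>
   ('m, 'n) multiplier \<Rightarrow> (real ^ 2) set" where
  "contact_patch A1 b1 A2 b2 r q \<mu> =
     {p. \<exists>\<alpha> y1 y2. solves A1 b1 A2 b2 r q (p, \<alpha>, y1, y2) \<mu>}"

text \<open>In the two impact laws, \<open>v\<close> and \<open>v'\<close> are the pre- and post-impact velocities and \<open>n i\<close>, for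
  \<open>i = 1, \<dots>, nv\<close>, are the contact normals at the vertices of the contact patch.\<close>

definition moreau_vertex_law ::
  "real ^ 6 ^ 6 \<Rightarrow> nat \<Rightarrow> (nat \<Rightarrow> real ^ 6) \<Rightarrow> real ^ 6 \<Rightarrow> real ^ 6 \<Rightarrow> bool" where
  "moreau_vertex_law M nv n v v' \<longleftrightarrow>
     (\<exists>\<Lambda> :: nat \<Rightarrow> real.
        (\<forall>i \<in> {1..nv}. 0 \<le> \<Lambda> i) \<and>
        v' = v + matrix_inv M *v (\<Sum>i = 1..nv. \<Lambda> i *\<^sub>R n i) \<and>
        (\<forall>i \<in> {1..nv}. 0 \<le> n i \<bullet> v') \<and>
        0 = (\<Sum>i = 1..nv. \<Lambda> i *\<^sub>R n i) \<bullet> v')"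

definition patch_law ::
  "real ^ 2 ^ 'm \<Rightarrow> real ^ 'm \<Rightarrow> real ^ 2 ^ 'n \<Rightarrow> real ^ 'n \<Rightarrow> real \<Rightarrow> config \<Rightarrow>
   real ^ 6 ^ 6 \<Rightarrow> real ^ 6 \<Rightarrow> real ^ 6 \<Rightarrow> bool" where
  "patch_law A1 b1 A2 b2 r q M v v' \<longleftrightarrow>
     (\<exists>\<Lambda> zI \<mu>I.
        0 \<le> \<Lambda> \<and> solves A1 b1 A2 b2 r q zI \<mu>I \<and>
        v' = v + matrix_inv M *v (\<Lambda> *\<^sub>R contact_normal A1 zI \<mu>I q) \<and>
        0 = contact_normal A1 zI \<mu>I q \<bullet> v' \<and>
        (\<forall>z \<mu>. solves A1 b1 A2 b2 r q z \<mu> \<longrightarrow> 0 \<le> contact_normal A1 z \<mu> q \<bullet> v'))"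

end

(* KKT points are saddle points of the Lagrangian, so primal and dual optima can be paired freely and the contact
   patch does not depend on the multiplier.  Stationarity in y1 gives n_tr = -2 mu_1c (p - y1), and mu_1c > 0 because
   mu_1c = 0 would force all halfspace multipliers to vanish when Phi = 0.  Hence changing the multiplier only rescales
   the contact normal by a positive factor.  For a fixed multiplier the contact normal is affine in p, and the patch is
   compact and convex, so by Krein-Milman all contact normals lie in the cone of the vertex normals and both laws ask
   for the same impulses.  A zero total impulse is excluded by the approaching pre-impact velocity. *)

theory Submission
  imports Defs
begin

section \<open>Coordinates in six dimensions and contact wrenches\<close>

lemma exhaust_6:
  fixes x :: 6
  shows "x = 1 \<or> x = 2 \<or> x = 3 \<or> x = 4 \<or> x = 5 \<or> x = 6"
proof (induct x)
  case (of_int k)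
  then have "0 \<le> k" "k < 6" by simp_all
  then have "k = 0 \<or> k = 1 \<or> k = 2 \<or> k = 3 \<or> k = 4 \<or> k = 5" by arith
  then show ?case by auto
qed

lemma forall_6: "(\<forall>i :: 6. P i) \<longleftrightarrow> P 1 \<and> P 2 \<and> P 3 \<and> P 4 \<and> P 5 \<and> P 6"
  by (metis exhaust_6)

lemma vector_6 [simp]:
  "(vector [x1, x2, x3, x4, x5, x6] :: 'a::zero ^ 6) $ 1 = x1"
  "(vector [x1, x2, x3, x4, x5, x6] :: 'a::zero ^ 6) $ 2 = x2"
  "(vector [x1, x2, x3, x4, x5, x6] :: 'a::zero ^ 6) $ 3 = x3"
  "(vector [x1, x2, x3, x4, x5, x6] :: 'a::zero ^ 6) $ 4 = x4"
  "(vector [x1, x2, x3, x4, x5, x6] :: 'a::zero ^ 6) $ 5 = x5"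
  "(vector [x1, x2, x3, x4, x5, x6] :: 'a::zero ^ 6) $ 6 = x6"
  unfolding vector_def by auto

text \<open>Treats the contact normal as a function of the contact point \<open>p\<close> and the
  force \<open>t\<close>, so that linearity in \<open>t\<close> and affinity in \<open>p\<close> can
  be stated separately. The moment arms start at the two body centres \<open>c1\<close> and
  \<open>c2\<close>.\<close>

definition contact_wrench :: "config \<Rightarrow> real ^ 2 \<Rightarrow> real ^ 2 \<Rightarrow> real ^ 6" where
  "contact_wrench q p t =
     vector [t $ 1, t $ 2, cross2 (p - fst q) t,
             - (t $ 1), - (t $ 2), - cross2 (p - fst (snd (snd q))) t]"

lemma cross2_scaleR_right: "cross2 a (k *\<^sub>R t) = k * cross2 a t"
  by (simp add: cross2_def algebra_simps)

lemma contact_wrench_scaleR: "contact_wrench q p (k *\<^sub>R t) = k *\<^sub>R contact_wrench q p t"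
  by (simp add: contact_wrench_def vec_eq_iff forall_6 cross2_scaleR_right)

text \<open>The offset \<open>c\<close> is constant, so weights summing to one reproduce it; no sign
  condition on the weights enters.\<close>

lemma cross2_affine_comb:
  assumes "sum u I = 1"
  shows "cross2 ((\<Sum>i\<in>I. u i *\<^sub>R x i) - c) t = (\<Sum>i\<in>I. u i * cross2 (x i - c) t)"
proof -
  have "(\<Sum>i\<in>I. u i * cross2 (x i - c) t)
      = (\<Sum>i\<in>I. u i * x i $ 1 * t $ 2 - u i * x i $ 2 * t $ 1 - u i * (c $ 1 * t $ 2 - c $ 2 * t $ 1))"
    by (intro sum.cong) (auto simp: cross2_def algebra_simps)
  also have "\<dots> = (\<Sum>i\<in>I. u i * x i $ 1) * t $ 2 - (\<Sum>i\<in>I. u i * x i $ 2) * t $ 1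
      - sum u I * (c $ 1 * t $ 2 - c $ 2 * t $ 1)"
    by (simp add: sum_subtractf sum_distrib_right)
  finally show ?thesis
    using assms by (simp add: cross2_def algebra_simps)
qed

lemma contact_wrench_affine_comb:
  assumes "sum u I = 1"
  shows "contact_wrench q (\<Sum>i\<in>I. u i *\<^sub>R x i) t = (\<Sum>i\<in>I. u i *\<^sub>R contact_wrench q (x i) t)"
  using assms
  by (simp add: contact_wrench_def vec_eq_iff forall_6 cross2_affine_comb
      sum_negf flip: sum_distrib_right)

lemma contact_normal_eq_wrench:
  "contact_normal A1 z \<mu> q
     = contact_wrench q (fst z) (- (rot (fst (snd q)) *v (transpose A1 *v fst \<mu>)))"
  by (cases z; cases \<mu>; cases q) (simp add: contact_wrench_def Let_def)

section \<open>Expansion and derivative of the Lagrangian\<close>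

lemma rot_transpose_inner: "x \<bullet> (transpose (rot \<theta>) *v y) = (rot \<theta> *v x) \<bullet> y"
  by (metis dot_lmul_matrix vector_transpose_matrix)

lemma halfspace_con_add:
  "halfspace_con A b r c \<xi> (\<alpha> + da) (y + d)
     = halfspace_con A b r c \<xi> \<alpha> y + (A *v (transpose (rot \<xi>) *v d) - da *\<^sub>R b)"
  by (simp add: halfspace_con_def matrix_vector_right_distrib matrix_vector_mult_diff_distrib
      algebra_simps)

lemma disc_con_add:
  "disc_con r (p + dp) (y + d)
     = disc_con r p y + 2 * ((p - y) \<bullet> (dp - d)) + (dp - d) \<bullet> (dp - d)"
  by (simp add: disc_con_def algebra_simps inner_commute)

text \<open>The derivative of the Lagrangian at \<open>(p, \<alpha>, y1, y2)\<close> in direction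
  \<open>(dp, da, d1, d2)\<close>; constants such as \<open>r\<close> have dropped out.\<close>

fun lagrangian_slope ::
  "real ^ 2 ^ 'm \<Rightarrow> real ^ 'm \<Rightarrow> real ^ 2 ^ 'n \<Rightarrow> real ^ 'n \<Rightarrow> config \<Rightarrow>
   ('m, 'n) multiplier \<Rightarrow> primal \<Rightarrow> primal \<Rightarrow> real" where
  "lagrangian_slope A1 b1 A2 b2 (c1, \<xi>1, c2, \<xi>2) (\<mu>1p, \<mu>2p, \<mu>1c, \<mu>2c) (p, \<alpha>, y1, y2) (dp, da, d1, d2) =
     da + \<mu>1p \<bullet> (A1 *v (transpose (rot \<xi>1) *v d1) - da *\<^sub>R b1)
        + \<mu>2p \<bullet> (A2 *v (transpose (rot \<xi>2) *v d2) - da *\<^sub>R b2)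
        + 2 * \<mu>1c * ((p - y1) \<bullet> (dp - d1)) + 2 * \<mu>2c * ((p - y2) \<bullet> (dp - d2))"

text \<open>The expansion is exact: only the disc constraints are quadratic, and for nonnegative
  \<open>\<mu>1c\<close>, \<open>\<mu>2c\<close> the remainder is nonnegative. This is all the
  convexity that the saddle point argument uses.\<close>

lemma lagrangian_add:
  "lagrangian A1 b1 A2 b2 r q (\<mu>1p, \<mu>2p, \<mu>1c, \<mu>2c) (z + (dp, da, d1, d2))
     = lagrangian A1 b1 A2 b2 r q (\<mu>1p, \<mu>2p, \<mu>1c, \<mu>2c) z
       + lagrangian_slope A1 b1 A2 b2 q (\<mu>1p, \<mu>2p, \<mu>1c, \<mu>2c) z (dp, da, d1, d2)
       + \<mu>1c * ((dp - d1) \<bullet> (dp - d1)) + \<mu>2c * ((dp - d2) \<bullet> (dp - d2))"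
  by (cases q; cases z)
    (simp add: halfspace_con_add disc_con_add inner_add_right distrib_left)

lemma lagrangian_has_derivative:
  "(lagrangian A1 b1 A2 b2 r q \<mu> has_derivative lagrangian_slope A1 b1 A2 b2 q \<mu> z) (at z)"
proof -
  obtain c1 \<xi>1 c2 \<xi>2 where q: "q = (c1, \<xi>1, c2, \<xi>2)" by (cases q)
  obtain \<mu>1p \<mu>2p \<mu>1c \<mu>2c where m: "\<mu> = (\<mu>1p, \<mu>2p, \<mu>1c, \<mu>2c)" by (cases \<mu>)
  \<comment> \<open>Pattern-matched tuples are replaced by projections, so that the derivative rules
    apply to a single variable \<open>z\<close>.\<close>
  have L: "lagrangian A1 b1 A2 b2 r q \<mu> = (\<lambda>z. (fst (snd z) - 1)
     + \<mu>1p \<bullet> (A1 *v (transpose (rot \<xi>1) *v (fst (snd (snd z)) - c1)) - (fst (snd z) *\<^sub>R b1 - vec r))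
     + \<mu>2p \<bullet> (A2 *v (transpose (rot \<xi>2) *v (snd (snd (snd z)) - c2)) - (fst (snd z) *\<^sub>R b2 - vec r))
     + \<mu>1c * ((fst z - fst (snd (snd z))) \<bullet> (fst z - fst (snd (snd z))) - r\<^sup>2)
     + \<mu>2c * ((fst z - snd (snd (snd z))) \<bullet> (fst z - snd (snd (snd z))) - r\<^sup>2))"
    by (auto simp: fun_eq_iff q m halfspace_con_def disc_con_def)
  have D: "lagrangian_slope A1 b1 A2 b2 q \<mu> z = (\<lambda>d. fst (snd d)
        + \<mu>1p \<bullet> (A1 *v (transpose (rot \<xi>1) *v fst (snd (snd d))) - fst (snd d) *\<^sub>R b1)
        + \<mu>2p \<bullet> (A2 *v (transpose (rot \<xi>2) *v snd (snd (snd d))) - fst (snd d) *\<^sub>R b2)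
        + 2 * \<mu>1c * ((fst z - fst (snd (snd z))) \<bullet> (fst d - fst (snd (snd d))))
        + 2 * \<mu>2c * ((fst z - snd (snd (snd z))) \<bullet> (fst d - snd (snd (snd d)))))"
    by (cases z) (auto simp: fun_eq_iff q m)
  show ?thesis
    unfolding L D
    by (auto intro!: derivative_eq_intros
        bounded_linear.has_derivative[OF matrix_vector_mul_bounded_linear]
        simp: fun_eq_iff algebra_simps inner_commute simp del: transpose_matrix_vector)
qed

section \<open>KKT points as saddle points\<close>

lemma nonneg_inner_vec: "0 \<le> x \<Longrightarrow> y \<le> 0 \<Longrightarrow> x \<bullet> y \<le> (0 :: real)" for x y :: "real ^ 'k"
  by (auto simp: inner_vec_def less_eq_vec_def intro!: sum_nonpos mult_nonneg_nonpos)

text \<open>All summands of the inner product have the same sign, so the sum vanishes only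
  termwise.\<close>

lemma complementary_inner:
  fixes x y :: "real ^ 'k"
  assumes "0 \<le> x" "y \<le> 0"
  shows "(\<forall>i. x $ i * y $ i = 0) \<longleftrightarrow> x \<bullet> y = 0"
proof -
  have "(\<Sum>i\<in>UNIV. - (x $ i * y $ i)) = 0 \<longleftrightarrow> (\<forall>i\<in>UNIV. - (x $ i * y $ i) = 0)"
    using assms by (intro sum_nonneg_eq_0_iff) (auto simp: less_eq_vec_def mult_nonneg_nonpos)
  then show ?thesis by (simp add: inner_vec_def sum_negf)
qed

text \<open>Each constraint term is a nonnegative multiplier times a nonpositive value; the gap
  closes exactly under complementary slackness.\<close>

lemma lagrangian_le_objective:
  assumes "feasible A1 b1 A2 b2 r q z" "nonneg_multiplier \<mu>"
  shows "lagrangian A1 b1 A2 b2 r q \<mu> z \<le> objective z"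
    and "lagrangian A1 b1 A2 b2 r q \<mu> z = objective z \<longleftrightarrow> complementary A1 b1 A2 b2 r q z \<mu>"
proof -
  obtain c1 \<xi>1 c2 \<xi>2 where q: "q = (c1, \<xi>1, c2, \<xi>2)" by (cases q)
  obtain \<mu>1p \<mu>2p \<mu>1c \<mu>2c where m: "\<mu> = (\<mu>1p, \<mu>2p, \<mu>1c, \<mu>2c)" by (cases \<mu>)
  obtain p \<alpha> y1 y2 where z: "z = (p, \<alpha>, y1, y2)" by (cases z)
  let ?h1 = "halfspace_con A1 b1 r c1 \<xi>1 \<alpha> y1" and ?h2 = "halfspace_con A2 b2 r c2 \<xi>2 \<alpha> y2"
  have nn: "0 \<le> \<mu>1p" "0 \<le> \<mu>2p" "?h1 \<le> 0" "?h2 \<le> 0" using assms by (auto simp: q m z)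
  have "\<mu>1p \<bullet> ?h1 \<le> 0" "\<mu>2p \<bullet> ?h2 \<le> 0" "\<mu>1c * disc_con r p y1 \<le> 0" "\<mu>2c * disc_con r p y2 \<le> 0"
    using assms by (auto simp: q m z nonneg_inner_vec mult_nonneg_nonpos)
  then show "lagrangian A1 b1 A2 b2 r q \<mu> z \<le> objective z"
    and "lagrangian A1 b1 A2 b2 r q \<mu> z = objective z \<longleftrightarrow> complementary A1 b1 A2 b2 r q z \<mu>"
    unfolding q m z complementary.simps complementary_inner[OF nn(1,3)] complementary_inner[OF nn(2,4)]
      lagrangian.simps objective.simps by linarith+
qed

lemma kkt_slope:
  assumes "kkt A1 b1 A2 b2 r q z \<mu>"
  shows "lagrangian_slope A1 b1 A2 b2 q \<mu> z d = 0"
proof -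
  have "(lagrangian A1 b1 A2 b2 r q \<mu> has_derivative (\<lambda>_. 0)) (at z)"
    using assms by (simp add: kkt_def)
  from has_derivative_unique[OF lagrangian_has_derivative this] show ?thesis by simp
qed

text \<open>Stationarity removes the linear term of the exact expansion, leaving squares with
  nonnegative weights.\<close>

lemma kkt_lagrangian_min:
  assumes "kkt A1 b1 A2 b2 r q z \<mu>"
  shows "lagrangian A1 b1 A2 b2 r q \<mu> z \<le> lagrangian A1 b1 A2 b2 r q \<mu> z'"
proof -
  obtain \<mu>1p \<mu>2p \<mu>1c \<mu>2c where m: "\<mu> = (\<mu>1p, \<mu>2p, \<mu>1c, \<mu>2c)" by (cases \<mu>)
  obtain dp da d1 d2 where d: "z' - z = (dp, da, d1, d2)" by (cases "z' - z")
  have "0 \<le> \<mu>1c" "0 \<le> \<mu>2c" using assms by (auto simp: m kkt_def)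
  moreover have "z' = z + (dp, da, d1, d2)" by (simp flip: d)
  ultimately show ?thesis
    using kkt_slope[OF assms] by (simp add: lagrangian_add m)
qed

text \<open>Optimal primal and dual solutions can be paired freely: a second primal optimum has the same objective,
  hence also minimizes the Lagrangian of the given multiplier.\<close>

lemma solves_primal_exchange:
  assumes s: "solves A1 b1 A2 b2 r q z \<mu>" and o: "primal_optimal A1 b1 A2 b2 r q z'"
  shows "solves A1 b1 A2 b2 r q z' \<mu>"
proof -
  let ?L = "lagrangian A1 b1 A2 b2 r q \<mu>"
  have k: "kkt A1 b1 A2 b2 r q z \<mu>" and po: "primal_optimal A1 b1 A2 b2 r q z"
    and d: "dual_optimal A1 b1 A2 b2 r q \<mu>" and nn: "nonneg_multiplier \<mu>"
    using s by (auto simp: solves_def kkt_def)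
  have f: "feasible A1 b1 A2 b2 r q z'" "feasible A1 b1 A2 b2 r q z"
    using o po by (auto simp: primal_optimal_def)
  have "objective z' = objective z" using o po f unfolding primal_optimal_def by (blast intro: antisym)
  moreover have "?L z = objective z"
    using lagrangian_le_objective(2)[OF f(2) nn] k by (simp add: kkt_def)
  \<comment> \<open>Squeeze: \<open>?L z\<close> is at most \<open>?L z'\<close>, which is at most
    \<open>objective z'\<close>, and the two ends coincide.\<close>
  ultimately have e: "?L z' = ?L z" "?L z' = objective z'"
    using kkt_lagrangian_min[OF k, of z'] lagrangian_le_objective(1)[OF f(1) nn] by auto
  have "\<forall>x\<in>UNIV. ?L z' \<le> ?L x" using kkt_lagrangian_min[OF k] e(1) by simp
  \<comment> \<open>Fermat's rule: \<open>z'\<close> minimizes the Lagrangian over the whole space,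
    hence is stationary.\<close>
  then have "lagrangian_slope A1 b1 A2 b2 q \<mu> z' = (\<lambda>_. 0)"
    using differential_zero_maxmin[OF UNIV_I open_UNIV lagrangian_has_derivative] by blast
  then have "(?L has_derivative (\<lambda>_. 0)) (at z')"
    using lagrangian_has_derivative[of A1 b1 A2 b2 r q \<mu> z'] by simp
  then show ?thesis
    using o d f nn e(2) lagrangian_le_objective(2)[OF f(1) nn] by (simp add: solves_def kkt_def)
qed

section \<open>Multipliers and contact forces at zero distance\<close>

lemma primal_optimal_objective:
  assumes "Phi A1 b1 A2 b2 r q = 0" "primal_optimal A1 b1 A2 b2 r q z"
  shows "objective z = 0"
proof -
  have "Phi A1 b1 A2 b2 r q = objective z"
    unfolding Phi_def using assms(2)
    by (intro cInf_eq_minimum) (unfold primal_optimal_def, blast+)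
  then show ?thesis using assms(1) by simp
qed

lemma vec_inner: "x \<bullet> (vec r :: real ^ 'k) = r * (\<Sum>i\<in>UNIV. x $ i)"
  by (simp add: inner_vec_def sum_distrib_left mult.commute)

text \<open>The terms \<open>x $ i * (b $ i - r)\<close> are nonnegative with sum at most zero, so
  each vanishes, and the second factors are positive.\<close>

lemma nonneg_inner_positive_imp_zero:
  fixes x b :: "real ^ 'k"
  assumes "0 \<le> x" "\<forall>i. 0 < b $ i - r" "x \<bullet> b - r * (\<Sum>i\<in>UNIV. x $ i) \<le> 0"
  shows "x = 0"
proof -
  have "(\<Sum>i\<in>UNIV. x $ i * (b $ i - r)) \<le> 0"
    using assms(3) by (simp add: inner_vec_def algebra_simps sum_subtractf sum_distrib_left)
  moreover have "0 \<le> x $ i * (b $ i - r)" for i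
    using assms by (intro mult_nonneg_nonneg) (auto simp: less_eq_vec_def intro: less_imp_le)
  ultimately have "\<forall>i\<in>UNIV. x $ i * (b $ i - r) = 0"
    by (subst sum_nonneg_eq_0_iff[symmetric]) (auto intro!: antisym sum_nonneg)
  then show ?thesis using assms(2) by (auto simp: vec_eq_iff)
qed

text \<open>The force direction is dictated by the primal point alone, and positivity of
  \<open>\<mu>1c\<close> makes the ratio of two such multipliers a positive scaling factor.\<close>

lemma contact_multiplier:
  fixes A1 :: "real ^ 2 ^ 'm" and A2 :: "real ^ 2 ^ 'n"
  assumes b: "\<forall>i. 0 < b1 $ i - r" "\<forall>i. 0 < b2 $ i - r"
    and Phi: "Phi A1 b1 A2 b2 r q = 0"
    and s: "solves A1 b1 A2 b2 r q (p, \<alpha>, y1, y2) (\<mu>1p, \<mu>2p, \<mu>1c, \<mu>2c)"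
  shows "0 < \<mu>1c"
    and "rot (fst (snd q)) *v (transpose A1 *v \<mu>1p) = (2 * \<mu>1c) *\<^sub>R (p - y1)"
proof -
  obtain c1 \<xi>1 c2 \<xi>2 where q: "q = (c1, \<xi>1, c2, \<xi>2)" by (cases q)
  have k: "kkt A1 b1 A2 b2 r q (p, \<alpha>, y1, y2) (\<mu>1p, \<mu>2p, \<mu>1c, \<mu>2c)"
    and po: "primal_optimal A1 b1 A2 b2 r q (p, \<alpha>, y1, y2)"
    using s by (auto simp: solves_def)
  have nn: "0 \<le> \<mu>1p" "0 \<le> \<mu>2p" "0 \<le> \<mu>1c" using k by (auto simp: kkt_def)
  have \<alpha>: "\<alpha> = 1" using primal_optimal_objective[OF Phi po] by simp
  have D: "lagrangian_slope A1 b1 A2 b2 q (\<mu>1p, \<mu>2p, \<mu>1c, \<mu>2c) (p, \<alpha>, y1, y2) (dp, da, d1, d2) = 0"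
    for dp da d1 d2
    by (rule kkt_slope[OF k])
  \<comment> \<open>The slope vanishes in every direction. Perturbing \<alpha>, \<open>y1\<close>,
    \<open>y2\<close> and \<open>p\<close> separately gives the normalisation of the multipliers and
    three force balances.\<close>
  have norm: "\<mu>1p \<bullet> b1 + \<mu>2p \<bullet> b2 = 1"
    using D[of 0 1 0 0] by (simp add: q algebra_simps)
  have y1: "\<mu>1p \<bullet> (A1 *v (transpose (rot \<xi>1) *v d)) = 2 * \<mu>1c * ((p - y1) \<bullet> d)" for d
    using D[of 0 0 d 0] by (simp add: q algebra_simps)
  have y2: "\<mu>2p \<bullet> (A2 *v (transpose (rot \<xi>2) *v d)) = 2 * \<mu>2c * ((p - y2) \<bullet> d)" for d
    using D[of 0 0 0 d] by (simp add: q algebra_simps)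
  have p: "\<mu>1c * ((p - y1) \<bullet> d) + \<mu>2c * ((p - y2) \<bullet> d) = 0" for d
    using D[of d 0 0 0] by (simp add: q algebra_simps)
  have adj: "\<mu>1p \<bullet> (A1 *v (transpose (rot \<xi>1) *v d)) = (rot \<xi>1 *v (transpose A1 *v \<mu>1p)) \<bullet> d" for d
    by (metis rot_transpose_inner dot_lmul_matrix transpose_matrix_vector)
  show "rot (fst (snd q)) *v (transpose A1 *v \<mu>1p) = (2 * \<mu>1c) *\<^sub>R (p - y1)"
    by (subst vector_eq_rdot[symmetric]) (metis q fst_conv snd_conv adj y1 inner_scaleR_left)
  have "\<mu>1c \<noteq> 0"
  proof
    assume "\<mu>1c = 0"
    \<comment> \<open>The balance in \<open>p\<close> passes the vanishing of the first disc force
      on to the second, and hence to the halfspace forces of both bodies.\<close>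
    then have z: "\<mu>1p \<bullet> (A1 *v (transpose (rot \<xi>1) *v d)) = 0"
      "\<mu>2p \<bullet> (A2 *v (transpose (rot \<xi>2) *v d)) = 0" for d
      using y1 y2 p[of d] by auto
    have "\<mu>1p \<bullet> halfspace_con A1 b1 r c1 \<xi>1 \<alpha> y1 = 0" "\<mu>2p \<bullet> halfspace_con A2 b2 r c2 \<xi>2 \<alpha> y2 = 0"
      using k by (auto simp: kkt_def q simp flip: complementary_inner)
    \<comment> \<open>With zero force and \<open>\<alpha> = 1\<close>, complementarity leaves only
      the pairing of each multiplier with \<open>b - vec r\<close>.\<close>
    then have "\<mu>1p \<bullet> b1 - r * (\<Sum>i\<in>UNIV. \<mu>1p $ i) = 0" "\<mu>2p \<bullet> b2 - r * (\<Sum>i\<in>UNIV. \<mu>2p $ i) = 0"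
      by (simp_all add: halfspace_con_def \<alpha> inner_diff_right z vec_inner del: transpose_matrix_vector)
    then have "\<mu>1p = 0" "\<mu>2p = 0"
      using nn b by (auto intro!: nonneg_inner_positive_imp_zero)
    then show False using norm by simp
  qed
  then show "0 < \<mu>1c" using nn by simp
qed

text \<open>The multiplier need not be unique when three edge lines of a shrunken body \<open>{x. A *v x \<le> b - vec r}\<close> meet
  in one point, but \<open>p - y1\<close> fixes the direction of the contact normal, so another multiplier only rescales it.\<close>

lemma contact_normal_rescale:
  assumes "\<forall>i. 0 < b1 $ i - r" "\<forall>i. 0 < b2 $ i - r" "Phi A1 b1 A2 b2 r q = 0"
    and "solves A1 b1 A2 b2 r q z \<mu>" "solves A1 b1 A2 b2 r q z \<mu>'"
  obtains k where "0 < k" "contact_normal A1 z \<mu>' q = k *\<^sub>R contact_normal A1 z \<mu> q"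
proof -
  obtain \<mu>1p \<mu>2p \<mu>1c \<mu>2c where m: "\<mu> = (\<mu>1p, \<mu>2p, \<mu>1c, \<mu>2c)" by (cases \<mu>)
  obtain \<nu>1p \<nu>2p \<nu>1c \<nu>2c where m': "\<mu>' = (\<nu>1p, \<nu>2p, \<nu>1c, \<nu>2c)" by (cases \<mu>')
  obtain p \<alpha> y1 y2 where z: "z = (p, \<alpha>, y1, y2)" by (cases z)
  note c = contact_multiplier[OF assms(1-3) assms(4)[unfolded z m]]
  note c' = contact_multiplier[OF assms(1-3) assms(5)[unfolded z m']]
  \<comment> \<open>Both forces are multiples of the same vector \<open>p - y1\<close>, with factors
    proportional to \<open>\<nu>1c\<close> and \<open>\<mu>1c\<close>.\<close>
  have "- (rot (fst (snd q)) *v (transpose A1 *v \<nu>1p))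
      = (\<nu>1c / \<mu>1c) *\<^sub>R (- (rot (fst (snd q)) *v (transpose A1 *v \<mu>1p)))"
    using c c' by simp
  then have "contact_normal A1 z \<mu>' q = (\<nu>1c / \<mu>1c) *\<^sub>R contact_normal A1 z \<mu> q"
    unfolding contact_normal_eq_wrench contact_wrench_scaleR[symmetric] by (simp add: m m')
  then show thesis using that[of "\<nu>1c / \<mu>1c"] c(1) c'(1) by simp
qed

section \<open>The contact patch as a compact convex set\<close>

lemma contact_patch_eq:
  assumes "Phi A1 b1 A2 b2 r q = 0" "solves A1 b1 A2 b2 r q z \<mu>"
  shows "contact_patch A1 b1 A2 b2 r q \<mu>
    = fst ` {z. feasible A1 b1 A2 b2 r q z \<and> fst (snd z) = 1}"
proof -
  have obj: "objective z' = fst (snd z') - 1" for z' by (cases z') simp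
  have po: "primal_optimal A1 b1 A2 b2 r q z" using assms(2) by (simp add: solves_def)
  then have min: "fst (snd z) = 1" using primal_optimal_objective[OF assms(1), of z] obj[of z] by simp
  \<comment> \<open>Zero distance puts the optimal \<alpha> at 1, so optimality becomes a condition
    that is free of the multiplier.\<close>
  have "primal_optimal A1 b1 A2 b2 r q z' \<longleftrightarrow> feasible A1 b1 A2 b2 r q z' \<and> fst (snd z') = 1" for z'
    using po min primal_optimal_objective[OF assms(1), of z'] unfolding primal_optimal_def obj by fastforce
  then have "solves A1 b1 A2 b2 r q z' \<mu> \<longleftrightarrow> feasible A1 b1 A2 b2 r q z' \<and> fst (snd z') = 1" for z'
    using solves_primal_exchange[OF assms(2), of z'] by (auto simp: solves_def)
  then show ?thesis
    unfolding contact_patch_def by (force simp: image_iff)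
qed

lemma disc_con_le_iff: "0 \<le> r \<Longrightarrow> disc_con r p y \<le> 0 \<longleftrightarrow> norm (p - y) \<le> r"
  by (auto simp: disc_con_def simp flip: power2_norm_eq_inner power2_le_iff_abs_le)

lemma rot_mult_transpose: "rot \<theta> *v (transpose (rot \<theta>) *v x) = x"
proof -
  have "cos \<theta> * (cos \<theta> * a) + sin \<theta> * (sin \<theta> * a) = ((cos \<theta>)\<^sup>2 + (sin \<theta>)\<^sup>2) * a" for a
    by (simp only: power2_eq_square distrib_right mult.assoc)
  then have *: "cos \<theta> * (cos \<theta> * a) + sin \<theta> * (sin \<theta> * a) = a" for a
    by simp
  show ?thesis
    by (simp add: vec_eq_iff forall_2 matrix_vector_mult_def sum_2 rot_def transpose_def
        algebra_simps * del: transpose_matrix_vector)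
qed

lemma halfspace_con_le_iff:
  "halfspace_con A b r c \<xi> 1 y \<le> 0 \<longleftrightarrow>
     A *v (transpose (rot \<xi>) *v y) \<le> b - vec r + A *v (transpose (rot \<xi>) *v c)"
  by (simp add: halfspace_con_def matrix_vector_mult_diff_distrib algebra_simps
      del: transpose_matrix_vector)

text \<open>Fixing \<open>\<alpha> = 1\<close> exhibits the optimal set as an intersection of
  preimages of closed convex sets under linear maps; convexity and closedness are then both
  immediate.\<close>

lemma optimal_set_eq_vimages:
  assumes "0 \<le> r"
  shows "{z. feasible A1 b1 A2 b2 r (c1, \<xi>1, c2, \<xi>2) z \<and> fst (snd z) = 1} =
    (\<lambda>z. fst (snd z)) -` {1} \<inter>
    (\<lambda>z. A1 *v (transpose (rot \<xi>1) *v fst (snd (snd z)))) -` {..b1 - vec r + A1 *v (transpose (rot \<xi>1) *v c1)} \<inter>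
    (\<lambda>z. A2 *v (transpose (rot \<xi>2) *v snd (snd (snd z)))) -` {..b2 - vec r + A2 *v (transpose (rot \<xi>2) *v c2)} \<inter>
    (\<lambda>z. fst z - fst (snd (snd z))) -` cball 0 r \<inter>
    (\<lambda>z. fst z - snd (snd (snd z))) -` cball 0 r"
  using assms by (auto simp: halfspace_con_le_iff disc_con_le_iff simp del: transpose_matrix_vector)

lemma convex_closed_optimal_set:
  assumes "0 \<le> r"
  shows "convex {z. feasible A1 b1 A2 b2 r q z \<and> fst (snd z) = 1}"
    and "closed {z. feasible A1 b1 A2 b2 r q z \<and> fst (snd z) = 1}"
proof -
  obtain c1 \<xi>1 c2 \<xi>2 where q: "q = (c1, \<xi>1, c2, \<xi>2)" by (cases q)
  have lin: "linear (\<lambda>z :: primal. fst (snd z))"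
    "linear (\<lambda>z :: primal. A1 *v (transpose (rot \<xi>1) *v fst (snd (snd z))))"
    "linear (\<lambda>z :: primal. A2 *v (transpose (rot \<xi>2) *v snd (snd (snd z))))"
    "linear (\<lambda>z :: primal. fst z - fst (snd (snd z)))"
    "linear (\<lambda>z :: primal. fst z - snd (snd (snd z)))"
    by (auto intro!: linearI simp: algebra_simps matrix_vector_mult_scaleR
        simp del: transpose_matrix_vector)
  show "convex {z. feasible A1 b1 A2 b2 r q z \<and> fst (snd z) = 1}"
    unfolding q optimal_set_eq_vimages[OF assms]
    by (intro convex_Int convex_linear_vimage lin convex_cball convex_singleton
        is_interval_convex is_interval_ic)
  show "closed {z. feasible A1 b1 A2 b2 r q z \<and> fst (snd z) = 1}"
    unfolding q optimal_set_eq_vimages[OF assms]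
    by (intro closed_Int closed_vimage lin[THEN linear_continuous_on[OF linear_conv_bounded_linear[THEN iffD1]]]
        closed_cball closed_singleton closed_eucl_atMost)
qed

text \<open>At \<open>\<alpha> = 1\<close> the constraint describes the body shrunken by
  \<open>r\<close>, rotated and translated, which lies in the rigidly moved original body.\<close>

lemma bounded_body:
  assumes "0 \<le> r" "bounded {x. A *v x \<le> b}"
  shows "bounded {y. halfspace_con A b r c \<xi> 1 y \<le> 0}"
proof -
  let ?f = "\<lambda>x. c + rot \<xi> *v x"
  have "bounded ((+) c ` ((\<lambda>x. rot \<xi> *v x) ` {x. A *v x \<le> b}))"
    by (intro bounded_translation bounded_linear_image[OF assms(2)] matrix_vector_mul_bounded_linear)
  then have "bounded (?f ` {x. A *v x \<le> b})" by (simp add: image_image)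
  moreover have "y \<in> ?f ` {x. A *v x \<le> b}" if "halfspace_con A b r c \<xi> 1 y \<le> 0" for y
  proof
    show "y = ?f (transpose (rot \<xi>) *v (y - c))" by (simp only: rot_mult_transpose) simp
    have "A *v (transpose (rot \<xi>) *v (y - c)) \<le> b - vec r"
      using that by (simp add: halfspace_con_def del: transpose_matrix_vector)
    also have "\<dots> \<le> b" using assms(1) by (simp add: less_eq_vec_def)
    finally show "transpose (rot \<xi>) *v (y - c) \<in> {x. A *v x \<le> b}" by simp
  qed
  ultimately show ?thesis by (auto intro: bounded_subset)
qed

lemma bounded_optimal_set:
  assumes r: "0 \<le> r" and b: "bounded {x. A1 *v x \<le> b1}" "bounded {x. A2 *v x \<le> b2}"
  shows "bounded {z. feasible A1 b1 A2 b2 r q z \<and> fst (snd z) = 1}"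
proof -
  obtain c1 \<xi>1 c2 \<xi>2 where q: "q = (c1, \<xi>1, c2, \<xi>2)" by (cases q)
  let ?Y1 = "{y. halfspace_con A1 b1 r c1 \<xi>1 1 y \<le> 0}"
  let ?Y2 = "{y. halfspace_con A2 b2 r c2 \<xi>2 1 y \<le> 0}"
  \<comment> \<open>Minkowski sum of the first shrunken body and a disc of radius \<open>r\<close>;
    it contains every optimal \<open>p\<close>.\<close>
  let ?P = "\<Union>x \<in> ?Y1. \<Union>y \<in> cball 0 r. {x + y}"
  have "bounded ?P"
    by (intro bounded_sums bounded_body bounded_cball r b)
  then have "bounded (?P \<times> {1} \<times> ?Y1 \<times> ?Y2)"
    by (intro bounded_Times bounded_body r b) simp_all
  moreover have "{z. feasible A1 b1 A2 b2 r q z \<and> fst (snd z) = 1} \<subseteq> ?P \<times> {1} \<times> ?Y1 \<times> ?Y2"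
  proof
    fix z assume z: "z \<in> {z. feasible A1 b1 A2 b2 r q z \<and> fst (snd z) = 1}"
    obtain p y1 y2 where zz: "z = (p, 1, y1, y2)" using z by (cases z) auto
    have "p = y1 + (p - y1)" by simp
    moreover have "y1 \<in> ?Y1" "y2 \<in> ?Y2" "p - y1 \<in> cball 0 r"
      using z r by (auto simp: q zz disc_con_le_iff)
    ultimately show "z \<in> ?P \<times> {1} \<times> ?Y1 \<times> ?Y2" unfolding zz by blast
  qed
  ultimately show ?thesis by (rule bounded_subset)
qed

text \<open>The patch is the linear image under \<open>fst\<close> of a compact convex set, so the
  finite-dimensional Krein-Milman theorem applies.\<close>

lemma contact_patch_hull:
  assumes "0 \<le> r" "bounded {x. A1 *v x \<le> b1}" "bounded {x. A2 *v x \<le> b2}"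
    and "Phi A1 b1 A2 b2 r q = 0" "solves A1 b1 A2 b2 r q z \<mu>"
  shows "contact_patch A1 b1 A2 b2 r q \<mu>
    = convex hull {x. x extreme_point_of contact_patch A1 b1 A2 b2 r q \<mu>}"
proof (rule Krein_Milman_Minkowski)
  let ?S = "{z. feasible A1 b1 A2 b2 r q z \<and> fst (snd z) = 1}"
  note patch = contact_patch_eq[OF assms(4,5)]
  have "compact ?S"
    using bounded_optimal_set[OF assms(1-3)] convex_closed_optimal_set(2)[OF assms(1)]
    by (simp add: compact_eq_bounded_closed)
  then show "compact (contact_patch A1 b1 A2 b2 r q \<mu>)"
    unfolding patch by (intro compact_continuous_image continuous_intros)
  show "convex (contact_patch A1 b1 A2 b2 r q \<mu>)"
    unfolding patch
    by (intro convex_linear_image convex_closed_optimal_set(1) assms(1) linear_fst)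
qed

section \<open>Vertex weights and the equivalence of the impact laws\<close>

lemma convex_hull_image_family:
  fixes w :: "'i \<Rightarrow> 'a :: real_vector"
  assumes "finite I" "inj_on w I"
  shows "convex hull (w ` I) = {(\<Sum>i\<in>I. u i *\<^sub>R w i) | u. (\<forall>i\<in>I. 0 \<le> u i) \<and> sum u I = 1}"
    (is "_ = ?R")
proof
  show "convex hull (w ` I) \<subseteq> ?R"
  proof
    fix y assume "y \<in> convex hull (w ` I)"
    then obtain u where "\<forall>x\<in>w ` I. 0 \<le> u x" "sum u (w ` I) = 1" "(\<Sum>x\<in>w ` I. u x *\<^sub>R x) = y"
      using assms(1) by (auto simp: convex_hull_finite)
    \<comment> \<open>Injectivity of \<open>w\<close> allows weights on points to be pulled back to
      weights on indices.\<close>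
    then show "y \<in> ?R"
      using assms(2) by (intro CollectI exI[of _ "u \<circ> w"]) (auto simp: sum.reindex)
  qed
  show "?R \<subseteq> convex hull (w ` I)"
    using assms(1) by clarify (intro convex_sum convex_convex_hull, auto intro: hull_inc)
qed

theorem mainTheorem3:
  fixes A1 :: "real ^ 2 ^ 'm" and b1 :: "real ^ 'm"
    and A2 :: "real ^ 2 ^ 'n" and b2 :: "real ^ 'n"
    and r :: real and M :: "real ^ 6 ^ 6"
    and q :: config and v v' :: "real ^ 6"
    and z :: primal and \<mu> :: "('m, 'n) multiplier"
    and nv :: nat and w :: "nat \<Rightarrow> real ^ 2" and zt :: "nat \<Rightarrow> primal"
  assumes "bounded {x. A1 *v x \<le> b1}" and "bounded {x. A2 *v x \<le> b2}"
    and "\<forall>i. norm (row i A1) = 1" and "\<forall>i. norm (row i A2) = 1"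
    and "0 < r" and "\<forall>i. 0 < b1 $ i - r" and "\<forall>i. 0 < b2 $ i - r"
    and "nondegenerate A1 b1 A2 b2 r q"
    and "\<forall>i j. i \<noteq> j \<longrightarrow> M $ i $ j = 0" and "\<forall>x. x \<noteq> 0 \<longrightarrow> 0 < x \<bullet> (M *v x)"
    and "Phi A1 b1 A2 b2 r q = 0"
    and "solves A1 b1 A2 b2 r q z \<mu>" and "contact_normal A1 z \<mu> q \<bullet> v < 0"
    and "bij_betw w {1..nv} {x. x extreme_point_of contact_patch A1 b1 A2 b2 r q \<mu>}"
    and "\<forall>i \<in> {1..nv}. primal_optimal A1 b1 A2 b2 r q (zt i) \<and> fst (zt i) = w i"
  shows "moreau_vertex_law M nv (\<lambda>i. contact_normal A1 (zt i) \<mu> q) v v' \<longleftrightarrow>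
         patch_law A1 b1 A2 b2 r q M v v'"
proof -
  let ?sol = "solves A1 b1 A2 b2 r q" and ?n = "\<lambda>z \<mu>. contact_normal A1 z \<mu> q"
  let ?patch = "contact_patch A1 b1 A2 b2 r q \<mu>"
  define N where "N i = ?n (zt i) \<mu>" for i
  \<comment> \<open>The translational force belonging to \<mu>; all contact normals with this
    multiplier share it and differ only through \<open>p\<close>.\<close>
  define t where "t = - (rot (fst (snd q)) *v (transpose A1 *v fst \<mu>))"
  have n: "?n z' \<mu> = contact_wrench q (fst z') t" for z'
    by (simp add: contact_normal_eq_wrench t_def)
  have zt: "fst (zt i) = w i" "?sol (zt i) \<mu>" if "i \<in> {1..nv}" for i
    using assms(15) that solves_primal_exchange[OF assms(12)] by auto
  have patch: "?patch = {(\<Sum>i = 1..nv. u i *\<^sub>R w i) | u. (\<forall>i\<in>{1..nv}. 0 \<le> u i) \<and> sum u {1..nv} = 1}"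
    using contact_patch_hull[OF less_imp_le[OF assms(5)] assms(1,2,11,12)] assms(14)
      convex_hull_image_family[of "{1..nv}" w] by (simp add: bij_betw_def)
  have comb: "?n z' \<mu> = (\<Sum>i = 1..nv. u i *\<^sub>R N i)"
    if "fst z' = (\<Sum>i = 1..nv. u i *\<^sub>R w i)" "sum u {1..nv} = 1" for z' u
    using that zt(1) by (simp add: n N_def contact_wrench_affine_comb)
  \<comment> \<open>Exchanging \<mu>' for \<mu> costs a positive factor \<open>k\<close>; the
    contact point is then expanded in the vertices.\<close>
  have cone: "\<exists>k u. 0 < k \<and> (\<forall>i\<in>{1..nv}. 0 \<le> u i) \<and> ?n z' \<mu>' = k *\<^sub>R (\<Sum>i = 1..nv. u i *\<^sub>R N i)"
    if s: "?sol z' \<mu>'" for z' \<mu>'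
  proof -
    have s': "?sol z' \<mu>"
      using s solves_primal_exchange[OF assms(12), of z'] by (simp add: solves_def)
    obtain k where k: "0 < k" "?n z' \<mu>' = k *\<^sub>R ?n z' \<mu>"
      using contact_normal_rescale[OF assms(6,7,11) s' s] by blast
    have "fst z' \<in> ?patch" using s' by (cases z') (auto simp: contact_patch_def)
    then obtain u where u: "fst z' = (\<Sum>i = 1..nv. u i *\<^sub>R w i)" "\<forall>i\<in>{1..nv}. 0 \<le> u i"
      "sum u {1..nv} = 1"
      unfolding patch by blast
    have "?n z' \<mu>' = k *\<^sub>R (\<Sum>i = 1..nv. u i *\<^sub>R N i)"
      by (simp only: k(2) comb[OF u(1,3)])
    then show ?thesis using k(1) u(2) by blast
  qed
  have nonneg: "0 \<le> ?n z' \<mu>' \<bullet> x"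
    if s: "?sol z' \<mu>'" and N: "\<forall>i\<in>{1..nv}. 0 \<le> N i \<bullet> x" for z' \<mu>' x
  proof -
    obtain k u where "0 < k" "\<forall>i\<in>{1..nv}. 0 \<le> u i" "?n z' \<mu>' = k *\<^sub>R (\<Sum>i = 1..nv. u i *\<^sub>R N i)"
      using cone[OF s] by blast
    then show ?thesis
      using N by (auto simp: inner_sum_left intro!: mult_nonneg_nonneg[of k] sum_nonneg)
  qed
  show ?thesis
    unfolding N_def[symmetric]
  proof
    assume "moreau_vertex_law M nv N v v'"
    then obtain l where l: "\<forall>i\<in>{1..nv}. 0 \<le> l i"
      and v': "v' = v + matrix_inv M *v (\<Sum>i = 1..nv. l i *\<^sub>R N i)"
      and N: "\<forall>i\<in>{1..nv}. 0 \<le> N i \<bullet> v'" and orth: "0 = (\<Sum>i = 1..nv. l i *\<^sub>R N i) \<bullet> v'"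
      unfolding moreau_vertex_law_def by blast
    define L where "L = sum l {1..nv}"
    \<comment> \<open>Zero total impulse would give \<open>v' = v\<close>, yet \<open>v\<close> is
      approaching along the given normal while \<open>v'\<close> is not.\<close>
    have "L \<noteq> 0"
    proof
      assume "L = 0"
      then have "\<forall>i\<in>{1..nv}. l i = 0"
        using l sum_nonneg_eq_0_iff[of "{1..nv}" l] unfolding L_def by blast
      then have "v' = v" using v' by simp
      then show False using nonneg[OF assms(12) N] assms(13) by simp
    qed
    moreover have "0 \<le> L" unfolding L_def by (intro sum_nonneg) (use l in blast)
    ultimately have L: "0 < L" by simp
    define u where "u i = l i / L" for i
    have "sum u {1..nv} = L / L" unfolding u_def L_def by (rule sum_divide_distrib[symmetric])
    then have u: "\<forall>i\<in>{1..nv}. 0 \<le> u i" "sum u {1..nv} = 1"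
      using l L by (auto simp: u_def)
    \<comment> \<open>The impulse-weighted mean of the vertices serves as the contact point at which
      the resultant acts.\<close>
    then have "(\<Sum>i = 1..nv. u i *\<^sub>R w i) \<in> ?patch" unfolding patch by blast
    then obtain zI where zI: "?sol zI \<mu>" "fst zI = (\<Sum>i = 1..nv. u i *\<^sub>R w i)"
      unfolding contact_patch_def by fastforce
    have "L *\<^sub>R ?n zI \<mu> = (\<Sum>i = 1..nv. l i *\<^sub>R N i)"
      using L by (simp add: comb[OF zI(2) u(2)] scaleR_sum_right u_def)
    then have "v' = v + matrix_inv M *v (L *\<^sub>R ?n zI \<mu>)" "0 = (L *\<^sub>R ?n zI \<mu>) \<bullet> v'"
      using v' orth by simp_all
    then show "patch_law A1 b1 A2 b2 r q M v v'"
      unfolding patch_law_def using L zI(1) nonneg[OF _ N]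
      by (intro exI[of _ L] exI[of _ zI] exI[of _ \<mu>] conjI) simp_all
  next
    assume "patch_law A1 b1 A2 b2 r q M v v'"
    then obtain L zI \<mu>I where L: "0 \<le> L" and s: "?sol zI \<mu>I"
      and v': "v' = v + matrix_inv M *v (L *\<^sub>R ?n zI \<mu>I)" and orth: "0 = ?n zI \<mu>I \<bullet> v'"
      and all: "\<forall>z \<mu>. ?sol z \<mu> \<longrightarrow> 0 \<le> ?n z \<mu> \<bullet> v'"
      unfolding patch_law_def by blast
    obtain k u where k: "0 < k" and u: "\<forall>i\<in>{1..nv}. 0 \<le> u i"
      and e: "?n zI \<mu>I = k *\<^sub>R (\<Sum>i = 1..nv. u i *\<^sub>R N i)"
      using cone[OF s] by blast
    \<comment> \<open>Vertex \<open>i\<close> receives the impulse \<open>L * k * u i\<close>, which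
      leaves the resultant unchanged.\<close>
    have e': "L *\<^sub>R ?n zI \<mu>I = (\<Sum>i = 1..nv. (L * k * u i) *\<^sub>R N i)"
      by (simp add: e scaleR_sum_right mult.assoc)
    have "(\<Sum>i = 1..nv. (L * k * u i) *\<^sub>R N i) \<bullet> v' = 0"
      unfolding e'[symmetric] using orth by simp
    moreover have "\<forall>i\<in>{1..nv}. 0 \<le> N i \<bullet> v'" using all zt(2) unfolding N_def by blast
    ultimately show "moreau_vertex_law M nv N v v'"
      unfolding moreau_vertex_law_def using v' L k u
      by (intro exI[of _ "\<lambda>i. L * k * u i"] conjI) (simp_all add: e')
  qed
qed

end
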